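(* Let $S\subseteq\mathbb{R}^n$ be a star-shaped body with diameter $D$ and $\eta(S)>0$. Then for any measurable partition $(S_1,S_3,S_2)$ of $S$ (i.e. $S_1,S_2,S_3$ measurable, pairwise disjoint, with union $S$), \[ \mathrm{vol}(S_3)\ \ge\ \frac{\eta(S)}{4D}\, d(S_1,S_2)\,\min\{\mathrm{vol}(S_1),\mathrm{vol}(S_2)\}, \] where $d(S_1,S_2)=\inf\{\|x-y\|: x\in S_1,\ y\in S_2\}$.
   Context: A compact body is a compact set $S\subseteq\mathbb{R}^n$ with nonempty interior such that $S$ equals the closure of its interior. The kernel of $S$ is $K_S=\{x\in S:\ [x,y]\subseteq S \text{ for all } y\in S\}$, where $[x,y]$ is the closed line segment. $S$ is star-shaped if $K_S\neq\emptyset$; a star-shaped body is a compact body that is star-shaped. $\eta(S)=\mathrm{vol}(K_S)/\mathrm{vol}(S)$, with $\mathrm{vol}$ the $n$-dimensional Lebesgue measure. *)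

theory Defs
  imports "HOL-Analysis.Analysis"
begin

definition compact_body :: "'a::euclidean_space set \<Rightarrow> bool" where
  "compact_body S \<longleftrightarrow> compact S \<and> interior S \<noteq> {} \<and> S = closure (interior S)"

definition kernel :: "'a::euclidean_space set \<Rightarrow> 'a set" where
  "kernel S = {x \<in> S. \<forall>y\<in>S. closed_segment x y \<subseteq> S}"

definition star_shaped :: "'a::euclidean_space set \<Rightarrow> bool" where
  "star_shaped S \<longleftrightarrow> kernel S \<noteq> {}"

definition star_shaped_body :: "'a::euclidean_space set \<Rightarrow> bool" where
  "star_shaped_body S \<longleftrightarrow> compact_body S \<and> star_shaped S"

definition vol :: "'a::euclidean_space set \<Rightarrow> real" where
  "vol A = measure lebesgue A"

definition eta :: "'a::euclidean_space set \<Rightarrow> real" where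
  "eta S = vol (kernel S) / vol S"

end

theory Submission
  imports Defs
begin

text \<open>
  If every segment from a point of A to a point of B spends a proportion at least \<delta> of its length
  in C, then vol C \<ge> \<delta> min (vol A) (vol B). To see this, approximate A and B by finite unions of
  boxes and cut both unions repeatedly by parallel hyperplanes in equal volume ratios, as in the
  Hadwiger--Ohmann proof of the Brunn--Minkowski inequality, until they are matched box by box. For
  each t the interpolated boxes (1 - t) P + t Q are pairwise disjoint, and by the inequality of
  arithmetic and geometric means the affine map from P onto (1 - t) P + t Q has Jacobian at least
  min 1 (vol Q / vol P). Integrating over t in (0, 1) gives the claim.

  Let K be the kernel of S, d the distance of S1 and S2, and D the diameter of S. A segment from S1
  to S2 with an endpoint in K stays in S, hence lies in S3 for a proportion at least d / D. This
  bounds vol S3 from below by d / D times each of min (vol S1) (vol (K \<inter> S2)),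
  min (vol (K \<inter> S1)) (vol S2) and vol (K \<inter> S3), and one of the three sets K \<inter> Si has at
  least a third of the volume of K.
\<close>

section \<open>Open boxes, finite families of them, and cuts by coordinate hyperplanes\<close>

definition open_box :: "'a::euclidean_space set \<Rightarrow> bool" where
  "open_box P \<longleftrightarrow> P \<noteq> {} \<and> (\<exists>a b. P = box a b)"

definition box_family :: "'a::euclidean_space set set \<Rightarrow> bool" where
  "box_family \<A> \<longleftrightarrow> finite \<A> \<and> \<A> \<noteq> {} \<and> disjoint \<A> \<and> (\<forall>P\<in>\<A>. open_box P)"

text \<open>Both components are cut in the same coordinate direction, but at independent heights
  \<open>s\<close> and \<open>t\<close>. The common direction keeps the interpolated boxes apart,
  while the independent heights leave the second cut free to be placed by volume.\<close>

definition pair_separated :: "'a::euclidean_space set \<times> 'a set \<Rightarrow> 'a set \<times> 'a set \<Rightarrow> bool" where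
  "pair_separated p q \<longleftrightarrow> (\<exists>i\<in>Basis. \<exists>s t.
     (\<forall>x\<in>fst p. x \<bullet> i < s) \<and> (\<forall>y\<in>snd p. y \<bullet> i < t) \<and> (\<forall>x\<in>fst q. s < x \<bullet> i) \<and> (\<forall>y\<in>snd q. t < y \<bullet> i))"

text \<open>The product equation is a division-free way to ask that every pair has the volume ratio
  of \<open>B\<close> to \<open>A\<close>. For sets of finite volume, the two sums together with the
  separation of the pairs say that the boxes exhaust \<open>A\<close> and \<open>B\<close> up to
  null sets, so the hyperplanes lost in cutting do no harm.\<close>

definition matching :: "'a::euclidean_space set \<Rightarrow> 'a set \<Rightarrow> ('a set \<times> 'a set) set \<Rightarrow> bool" where
  "matching A B R \<longleftrightarrow> finite R
     \<and> (\<forall>(P,Q)\<in>R. open_box P \<and> open_box Q \<and> P \<subseteq> A \<and> Q \<subseteq> B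
          \<and> measure lborel Q * measure lborel A = measure lborel P * measure lborel B)
     \<and> (\<Sum>(P,Q)\<in>R. measure lborel P) = measure lborel A
     \<and> (\<Sum>(P,Q)\<in>R. measure lborel Q) = measure lborel B
     \<and> pairwise (\<lambda>p q. pair_separated p q \<or> pair_separated q p) R"

lemma open_box_Int_halfspace_lt:
  assumes "open_box P" "i \<in> Basis" "P \<inter> {x. x \<bullet> i < s} \<noteq> {}"
  shows "open_box (P \<inter> {x. x \<bullet> i < s})"
proof -
  obtain a b where P: "P = box a b" using assms(1) by (auto simp: open_box_def)
  have "P \<inter> {x. x \<bullet> i < s} = box a (\<Sum>j\<in>Basis. (if j = i then min (b \<bullet> i) s else b \<bullet> j) *\<^sub>R j)"
    using assms(2) unfolding P by (auto simp: mem_box split: if_splits)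
  then show ?thesis using assms(3) unfolding open_box_def by blast
qed

lemma open_box_Int_halfspace_gt:
  assumes "open_box P" "i \<in> Basis" "P \<inter> {x. s < x \<bullet> i} \<noteq> {}"
  shows "open_box (P \<inter> {x. s < x \<bullet> i})"
proof -
  obtain a b where P: "P = box a b" using assms(1) by (auto simp: open_box_def)
  have "P \<inter> {x. s < x \<bullet> i} = box (\<Sum>j\<in>Basis. (if j = i then max (a \<bullet> i) s else a \<bullet> j) *\<^sub>R j) b"
    using assms(2) unfolding P by (auto simp: mem_box split: if_splits)
  then show ?thesis using assms(3) unfolding open_box_def by blast
qed

text \<open>Boxes are products of intervals, so two disjoint nonempty ones have disjoint projections
  to some axis. The upper endpoint of the lower projection is the height of the cut.\<close>

lemma open_box_separation:
  fixes P Q :: "'a::euclidean_space set"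
  assumes "open_box P" "open_box Q" "P \<inter> Q = {}"
  obtains i s where "i \<in> Basis"
    "P \<subseteq> {x. x \<bullet> i < s} \<and> Q \<subseteq> {x. s < x \<bullet> i} \<or> Q \<subseteq> {x. x \<bullet> i < s} \<and> P \<subseteq> {x. s < x \<bullet> i}"
proof -
  obtain a b where P: "P = box a b" "box a b \<noteq> {}" using assms(1) by (auto simp: open_box_def)
  obtain c d where Q: "Q = box c d" "box c d \<noteq> {}" using assms(2) by (auto simp: open_box_def)
  have "\<exists>i\<in>Basis. b \<bullet> i \<le> c \<bullet> i \<or> d \<bullet> i \<le> a \<bullet> i"
    using assms(3) P Q unfolding P(1) Q(1) disjoint_interval(4) box_ne_empty by force
  then obtain i where i: "i \<in> Basis" "b \<bullet> i \<le> c \<bullet> i \<or> d \<bullet> i \<le> a \<bullet> i" by blast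
  show thesis
  proof (cases "b \<bullet> i \<le> c \<bullet> i")
    case True
    then have "P \<subseteq> {x. x \<bullet> i < b \<bullet> i}" "Q \<subseteq> {x. b \<bullet> i < x \<bullet> i}"
      using i(1) by (force simp: P Q mem_box)+
    then show ?thesis using that i(1) by blast
  next
    case False
    then have "Q \<subseteq> {x. x \<bullet> i < d \<bullet> i}" "P \<subseteq> {x. d \<bullet> i < x \<bullet> i}"
      using i by (force simp: P Q mem_box)+
    then show ?thesis using that i(1) by blast
  qed
qed

text \<open>Boxes that miss \<open>H\<close> drop out and no box breaks into two, so the count never
  grows. The strict inequality for a missed box is what drives the induction on the number of
  boxes.\<close>

lemma box_family_restrict:
  assumes "box_family \<A>" and H: "\<And>P. open_box P \<Longrightarrow> P \<inter> H \<noteq> {} \<Longrightarrow> open_box (P \<inter> H)"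
    and "\<Union>\<A> \<inter> H \<noteq> {}"
  obtains \<C> where "box_family \<C>" "\<Union>\<C> = \<Union>\<A> \<inter> H" "card \<C> \<le> card \<A>"
    "\<And>P. P \<in> \<A> \<Longrightarrow> P \<inter> H = {} \<Longrightarrow> card \<C> < card \<A>"
proof -
  define \<A>' where "\<A>' = {P \<in> \<A>. P \<inter> H \<noteq> {}}"
  define \<C> where "\<C> = (\<lambda>P. P \<inter> H) ` \<A>'"
  have fin: "finite \<A>" and dis: "disjoint \<A>" and ob: "\<And>P. P \<in> \<A> \<Longrightarrow> open_box P"
    using assms(1) by (auto simp: box_family_def)
  have "disjoint \<C>"
    using dis unfolding \<C>_def \<A>'_def disjoint_def by blast
  moreover have "\<C> \<noteq> {}" using assms(3) unfolding \<C>_def \<A>'_def by blast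
  ultimately have "box_family \<C>"
    using fin ob H unfolding box_family_def \<C>_def \<A>'_def by auto
  moreover have "\<Union>\<C> = \<Union>\<A> \<inter> H" unfolding \<C>_def \<A>'_def by blast
  moreover have "card \<C> \<le> card \<A>'" unfolding \<C>_def by (rule card_image_le) (simp add: \<A>'_def fin)
  moreover have "card \<A>' \<le> card \<A>" unfolding \<A>'_def by (rule card_mono) (auto simp: fin)
  moreover have "card \<A>' < card \<A>" if "P \<in> \<A>" "P \<inter> H = {}" for P
    by (rule psubset_card_mono[OF fin]) (use that in \<open>auto simp: \<A>'_def\<close>)
  ultimately show thesis by (intro that[of \<C>]) (auto intro: le_less_trans)
qed

lemma open_box_properties:
  assumes "open_box P"
  shows "P \<in> sets borel" "emeasure lborel P < \<infinity>" "measure lborel P > 0" "bounded P" "open P" "P \<noteq> {}"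
proof -
  obtain a b where P: "P = box a b" "box a b \<noteq> {}" using assms by (auto simp: open_box_def)
  show "P \<in> sets borel" "emeasure lborel P < \<infinity>" "bounded P" "open P" "P \<noteq> {}"
    using P by (auto simp: open_box emeasure_lborel_box_eq bounded_box)
  show "measure lborel P > 0"
    using P(2) unfolding P(1) box_ne_empty
    by (auto simp: measure_lborel_box_eq less_imp_le inner_diff_left intro!: prod_pos)
qed

lemma box_family_properties:
  assumes "box_family \<A>"
  shows "\<Union>\<A> \<in> sets borel" "emeasure lborel (\<Union>\<A>) < \<infinity>" "bounded (\<Union>\<A>)" "open (\<Union>\<A>)" "\<Union>\<A> \<noteq> {}"
    "measure lborel (\<Union>\<A>) > 0"
proof -
  have fin: "finite \<A>" "\<A> \<noteq> {}" and ob: "\<And>P. P \<in> \<A> \<Longrightarrow> open_box P"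
    using assms by (auto simp: box_family_def)
  show o: "open (\<Union>\<A>)" using ob open_box_properties(5) by blast
  show b: "bounded (\<Union>\<A>)" using ob open_box_properties(4) fin by (intro bounded_Union) auto
  show s: "\<Union>\<A> \<in> sets borel" using o by simp
  show f: "emeasure lborel (\<Union>\<A>) < \<infinity>" using b emeasure_bounded_finite by blast
  show "\<Union>\<A> \<noteq> {}" using fin ob open_box_properties(6) by blast
  obtain P where P: "P \<in> \<A>" using fin by auto
  have "measure lborel P \<le> measure lborel (\<Union>\<A>)"
    by (rule measure_mono_fmeasurable) (use P ob open_box_properties(1) s f in \<open>auto simp: fmeasurable_def\<close>)
  then show "measure lborel (\<Union>\<A>) > 0" using open_box_properties(3)[OF ob[OF P]] by linarith
qed

text \<open>Only the hyperplane between the two open half-spaces is lost, and it is a null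
  set.\<close>

lemma measure_halfspaces:
  fixes A :: "'a::euclidean_space set"
  assumes "A \<in> sets borel" "emeasure lborel A < \<infinity>" "i \<in> Basis"
  shows "measure lborel (A \<inter> {x. x \<bullet> i < s}) + measure lborel (A \<inter> {x. s < x \<bullet> i}) = measure lborel A"
proof -
  have m: "{x::'a. x \<bullet> i < s} \<in> sets borel" "{x::'a. s < x \<bullet> i} \<in> sets borel" "{x::'a. x \<bullet> i = s} \<in> sets borel"
    by measurable
  have "negligible {x::'a. x \<bullet> i = s}" using assms(3) negligible_standard_hyperplane[of i s] by simp
  then have n: "emeasure lborel {x::'a. x \<bullet> i = s} = 0"
    using m(3) by (simp add: negligible_iff_emeasure0)
  have A: "A \<in> fmeasurable lborel" using assms by (simp add: fmeasurable_def)
  have "AE x in lborel. x \<bullet> i \<noteq> s"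
    by (rule AE_I[OF _ n]) (use m(3) in auto)
  then have "measure lborel A = measure lborel (A \<inter> {x. x \<bullet> i < s} \<union> A \<inter> {x. s < x \<bullet> i})"
    by (intro measure_eq_AE) (use assms(1) m in auto)
  also have "\<dots> = measure lborel (A \<inter> {x. x \<bullet> i < s}) + measure lborel (A \<inter> {x. s < x \<bullet> i})"
  proof -
    have "A \<inter> {x. s < x \<bullet> i} - A \<inter> {x. x \<bullet> i < s} = A \<inter> {x. s < x \<bullet> i}" by auto
    then show ?thesis
      using measure_Un2[OF fmeasurable_Int_fmeasurable[OF A] fmeasurable_Int_fmeasurable[OF A]] m
      by simp
  qed
  finally show ?thesis by simp
qed

section \<open>Matching boxes by parallel cuts\<close>

text \<open>Volume adds up over the disjoint boxes, and for one box it is a product of side lengths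
  of which only the one in direction \<open>i\<close> depends on \<open>s\<close>.\<close>

lemma continuous_measure_halfspace_lt:
  fixes \<B> :: "'a::euclidean_space set set"
  assumes "box_family \<B>" "i \<in> Basis"
  shows "continuous_on UNIV (\<lambda>s. measure lborel (\<Union>\<B> \<inter> {x. x \<bullet> i < s}))"
proof -
  have fin: "finite \<B>" and dis: "disjoint \<B>" and ob: "\<And>P. P \<in> \<B> \<Longrightarrow> open_box P"
    using assms by (auto simp: box_family_def)
  have m: "{x::'a. x \<bullet> i < s} \<in> sets borel" for s by measurable
  have "measure lborel (\<Union>\<B> \<inter> {x. x \<bullet> i < s}) = (\<Sum>P\<in>\<B>. measure lborel (P \<inter> {x. x \<bullet> i < s}))" for s
  proof -
    have "measure lborel (\<Union>P\<in>\<B>. P \<inter> {x. x \<bullet> i < s}) = (\<Sum>P\<in>\<B>. measure lborel (P \<inter> {x. x \<bullet> i < s}))"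
    proof (rule measure_finite_Union[OF fin])
      show "(\<lambda>P. P \<inter> {x. x \<bullet> i < s}) ` \<B> \<subseteq> sets lborel"
        using sets.Int[OF open_box_properties(1)[OF ob] m] by (auto simp del: borel_measurable_inner)
      show "disjoint_family_on (\<lambda>P. P \<inter> {x. x \<bullet> i < s}) \<B>"
        using dis unfolding disjoint_family_on_def disjoint_def by blast
      fix P assume "P \<in> \<B>"
      then have "emeasure lborel (P \<inter> {x. x \<bullet> i < s}) \<le> emeasure lborel P"
        using ob open_box_properties(1) by (intro emeasure_mono) auto
      then show "emeasure lborel (P \<inter> {x. x \<bullet> i < s}) \<noteq> \<infinity>"
        using open_box_properties(2)[OF ob[OF \<open>P \<in> \<B>\<close>]] by auto
    qed
    moreover have "(\<Union>P\<in>\<B>. P \<inter> {x. x \<bullet> i < s}) = \<Union>\<B> \<inter> {x. x \<bullet> i < s}" by blast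
    ultimately show ?thesis by simp
  qed
  moreover have "continuous_on UNIV (\<lambda>s. measure lborel (P \<inter> {x. x \<bullet> i < s}))" if "P \<in> \<B>" for P
  proof -
    obtain a b where P: "P = box a b" using ob[OF \<open>P \<in> \<B>\<close>] by (auto simp: open_box_def)
    define u where "u s j = (if j = i then min (b \<bullet> i) s else b \<bullet> j)" for s j
    have "P \<inter> {x. x \<bullet> i < s} = box a (\<Sum>j\<in>Basis. u s j *\<^sub>R j)" for s
      using assms(2) unfolding P u_def by (auto simp: mem_box split: if_splits)
    \<comment> \<open>Clamping at 0 covers the cuts below the box, where the truncated box is empty
      and the difference in direction \<open>i\<close> is negative.\<close>
    moreover have "measure lborel (box a (\<Sum>j\<in>Basis. u s j *\<^sub>R j)) = (\<Prod>j\<in>Basis. max 0 (u s j - a \<bullet> j))" for s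
    proof (cases "\<forall>j\<in>Basis. a \<bullet> j \<le> u s j")
      case True
      then show ?thesis by (auto simp: measure_lborel_box_eq inner_diff_left intro!: prod.cong)
    next
      case False
      then obtain j where "j \<in> Basis" "max 0 (u s j - a \<bullet> j) = 0" by force
      then have "(\<Prod>j\<in>Basis. max 0 (u s j - a \<bullet> j)) = 0" by auto
      then show ?thesis using False by (auto simp: measure_lborel_box_eq)
    qed
    moreover have "continuous_on UNIV (\<lambda>s. u s j)" for j
      by (cases "j = i") (auto simp: u_def intro!: continuous_intros)
    ultimately show ?thesis by (auto intro!: continuous_intros)
  qed
  ultimately show ?thesis by (auto intro!: continuous_intros)
qed

text \<open>Intermediate value theorem: the volume is continuous in the height, zero below the
  bounded family and full above it.\<close>

lemma halfspace_of_measure: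
  fixes \<B> :: "'a::euclidean_space set set"
  assumes "box_family \<B>" "i \<in> Basis" "0 \<le> v" "v \<le> measure lborel (\<Union>\<B>)"
  obtains s where "measure lborel (\<Union>\<B> \<inter> {x. x \<bullet> i < s}) = v"
proof -
  obtain M where M: "\<And>x. x \<in> \<Union>\<B> \<Longrightarrow> norm x \<le> M" "M > 0"
    using box_family_properties(3)[OF assms(1)] by (auto simp: bounded_pos)
  have M': "\<bar>x \<bullet> i\<bar> \<le> M" if "x \<in> \<Union>\<B>" for x
    using Basis_le_norm[OF assms(2), of x] M(1)[OF that] by linarith
  have "\<Union>\<B> \<inter> {x. x \<bullet> i < - M} = {}" using M' by fastforce
  moreover have "\<Union>\<B> \<inter> {x. x \<bullet> i < M + 1} = \<Union>\<B>" using M' by fastforce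
  ultimately have "\<exists>s\<ge>- M. s \<le> M + 1 \<and> measure lborel (\<Union>\<B> \<inter> {x. x \<bullet> i < s}) = v"
    using assms M(2)
    by (intro IVT') (auto intro: continuous_on_subset[OF continuous_measure_halfspace_lt])
  then show thesis using that by blast
qed

text \<open>Symmetry allows the splitting step to be used on either of the two families.\<close>

lemma matching_swap:
  assumes "matching A B R"
  shows "matching B A (prod.swap ` R)"
proof -
  have sep: "pair_separated (prod.swap p) (prod.swap q)" if "pair_separated p q" for p q :: "'a set \<times> 'a set"
    using that unfolding pair_separated_def by (metis fst_swap snd_swap)
  have "(\<Sum>(P,Q)\<in>prod.swap ` R. measure lborel P) = (\<Sum>(P,Q)\<in>R. measure lborel Q)"
       "(\<Sum>(P,Q)\<in>prod.swap ` R. measure lborel Q) = (\<Sum>(P,Q)\<in>R. measure lborel P)"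
    by (subst sum.reindex; auto simp: case_prod_unfold inj_on_def prod_eq_iff)+
  moreover have "pairwise (\<lambda>p q. pair_separated p q \<or> pair_separated q p) (prod.swap ` R)"
    unfolding pairwise_image
    by (rule pairwise_mono[of "\<lambda>p q. pair_separated p q \<or> pair_separated q p" R])
      (use assms sep in \<open>auto simp: matching_def\<close>)
  moreover have "open_box Q \<and> open_box P \<and> Q \<subseteq> B \<and> P \<subseteq> A
      \<and> measure lborel P * measure lborel B = measure lborel Q * measure lborel A" if "(P, Q) \<in> R" for P Q
    using assms that unfolding matching_def by (auto dest!: bspec)
  ultimately show ?thesis
    using assms unfolding matching_def by (intro conjI ballI; clarify?) simp_all
qed

text \<open>Both sets are cut in the same ratio \<open>\<alpha>\<close>, so each half keeps the
  volume ratio of the whole, and pairs from opposite halves are separated by the cuts at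
  \<open>s\<close> and \<open>t\<close> themselves.\<close>

lemma matching_halfspaces:
  fixes A B :: "'a::euclidean_space set"
  assumes R1: "matching (A \<inter> {x. x \<bullet> i < s}) (B \<inter> {x. x \<bullet> i < t}) R1"
    and R2: "matching (A \<inter> {x. s < x \<bullet> i}) (B \<inter> {x. t < x \<bullet> i}) R2"
    and A: "A \<in> sets borel" "emeasure lborel A < \<infinity>" and B: "B \<in> sets borel" "emeasure lborel B < \<infinity>"
    and i: "i \<in> Basis" and \<alpha>: "0 < \<alpha>" "\<alpha> < 1"
    and Aa: "measure lborel (A \<inter> {x. x \<bullet> i < s}) = \<alpha> * measure lborel A"
    and Ba: "measure lborel (B \<inter> {x. x \<bullet> i < t}) = \<alpha> * measure lborel B"
  shows "matching A B (R1 \<union> R2)"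
proof -
  note hA = measure_halfspaces[OF A i, of s] and hB = measure_halfspaces[OF B i, of t]
  have Ab: "measure lborel (A \<inter> {x. s < x \<bullet> i}) = (1 - \<alpha>) * measure lborel A"
    and Bb: "measure lborel (B \<inter> {x. t < x \<bullet> i}) = (1 - \<alpha>) * measure lborel B"
    using hA hB Aa Ba by (auto simp: algebra_simps)
  have fin: "finite R1" "finite R2" using R1 R2 by (auto simp: matching_def)
  have sep: "pair_separated p q" if "p \<in> R1" "q \<in> R2" for p q
  proof -
    have "fst p \<subseteq> {x. x \<bullet> i < s}" "snd p \<subseteq> {x. x \<bullet> i < t}" "fst q \<subseteq> {x. s < x \<bullet> i}" "snd q \<subseteq> {x. t < x \<bullet> i}"
      using R1 R2 that unfolding matching_def by fastforce+
    then show ?thesis using i unfolding pair_separated_def by blast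
  qed
  \<comment> \<open>A common pair would be separated from itself, which its nonempty first box
    forbids. Hence sums over \<open>R1\<close> and \<open>R2\<close> simply add.\<close>
  have "R1 \<inter> R2 = {}"
  proof -
    have False if "p \<in> R1" "p \<in> R2" for p
    proof -
      have "fst p \<noteq> {}" using R1 that(1) unfolding matching_def open_box_def by fastforce
      then show False using sep[OF that] unfolding pair_separated_def by fastforce
    qed
    then show ?thesis by blast
  qed
  then have sums: "sum f (R1 \<union> R2) = sum f R1 + sum f R2" for f :: "_ \<Rightarrow> real"
    using fin by (intro sum.union_disjoint)
  have "measure lborel Q * measure lborel A = measure lborel P * measure lborel B" if "(P,Q) \<in> R1 \<union> R2" for P Q
  proof -
    \<comment> \<open>\<open>c\<close> is the share of volume in the half that contains the pair,
      \<open>\<alpha>\<close> or \<open>1 - \<alpha>\<close>; being positive, it cancels.\<close>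
    have "\<exists>c>0. measure lborel Q * (c * measure lborel A) = measure lborel P * (c * measure lborel B)"
    proof (cases "(P,Q) \<in> R1")
      case True
      then show ?thesis using R1 \<alpha>(1) unfolding matching_def Aa Ba by blast
    next
      case False
      then show ?thesis using R2 that \<alpha>(2) unfolding matching_def Ab Bb
        by (intro exI[of _ "1 - \<alpha>"]) auto
    qed
    then show ?thesis by auto
  qed
  moreover have "open_box P \<and> open_box Q \<and> P \<subseteq> A \<and> Q \<subseteq> B" if "(P,Q) \<in> R1 \<union> R2" for P Q
    using that R1 R2 unfolding matching_def by blast
  moreover have "(\<Sum>(P,Q)\<in>R1 \<union> R2. measure lborel P) = measure lborel A"
    "(\<Sum>(P,Q)\<in>R1 \<union> R2. measure lborel Q) = measure lborel B"
    using R1 R2 hA hB unfolding sums matching_def by simp_all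
  moreover have "pairwise (\<lambda>p q. pair_separated p q \<or> pair_separated q p) (R1 \<union> R2)"
    unfolding pairwise_def
  proof (intro ballI impI)
    fix p q assume "p \<in> R1 \<union> R2" "q \<in> R1 \<union> R2" "p \<noteq> q"
    then consider "p \<in> R1" "q \<in> R1" | "p \<in> R2" "q \<in> R2" | "p \<in> R1" "q \<in> R2" | "p \<in> R2" "q \<in> R1"
      by blast
    then show "pair_separated p q \<or> pair_separated q p"
      using R1 R2 sep \<open>p \<noteq> q\<close> unfolding matching_def pairwise_def by cases metis+
  qed
  ultimately show ?thesis using fin unfolding matching_def by (intro conjI ballI; clarify?) simp_all
qed

text \<open>A hyperplane between two boxes of \<open>\<A>\<close> leaves fewer boxes on each side.
  The family \<open>\<B>\<close> is cut in the same direction at a height chosen by volume alone,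
  and its count grows on neither side, so \<open>IH\<close> applies to both halves.\<close>

lemma matching_split:
  fixes \<A> \<B> :: "'a::euclidean_space set set"
  assumes \<A>: "box_family \<A>" and \<B>: "box_family \<B>" and P: "P \<in> \<A>" "P' \<in> \<A>" "P \<noteq> P'"
    and IH: "\<And>\<C> \<D>. box_family \<C> \<Longrightarrow> box_family \<D> \<Longrightarrow> card \<C> < card \<A> \<Longrightarrow> card \<D> \<le> card \<B>
               \<Longrightarrow> \<exists>R. matching (\<Union>\<C>) (\<Union>\<D>) (R :: ('a set \<times> 'a set) set)"
  shows "\<exists>R. matching (\<Union>\<A>) (\<Union>\<B>) R"
proof -
  have "open_box P" "open_box P'" "P \<inter> P' = {}"
    using \<A> P unfolding box_family_def disjoint_def by auto
  from open_box_separation[OF this] obtain i s where i: "i \<in> Basis"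
    and "P \<subseteq> {x. x \<bullet> i < s} \<and> P' \<subseteq> {x. s < x \<bullet> i} \<or> P' \<subseteq> {x. x \<bullet> i < s} \<and> P \<subseteq> {x. s < x \<bullet> i}" .
  \<comment> \<open>\<open>Q\<close> and \<open>Q'\<close> are \<open>P\<close> and
    \<open>P'\<close> renamed so that \<open>Q\<close> lies on the lower side.\<close>
  then obtain Q Q' where Q: "Q \<in> \<A>" "Q' \<in> \<A>" "open_box Q" "open_box Q'"
      "Q \<subseteq> {x. x \<bullet> i < s}" "Q' \<subseteq> {x. s < x \<bullet> i}"
    using P \<open>open_box P\<close> \<open>open_box P'\<close> by blast
  let ?lt = "\<lambda>s. {x::'a. x \<bullet> i < s}" and ?gt = "\<lambda>s. {x::'a. s < x \<bullet> i}"
  note fA = box_family_properties[OF \<A>] and fB = box_family_properties[OF \<B>]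
  have ne: "\<Union>\<A> \<inter> ?lt s \<noteq> {}" "\<Union>\<A> \<inter> ?gt s \<noteq> {}"
    using Q open_box_properties(6) by blast+
  obtain \<A>1 where A1: "box_family \<A>1" "\<Union>\<A>1 = \<Union>\<A> \<inter> ?lt s" "card \<A>1 < card \<A>"
  proof (rule box_family_restrict[OF \<A> open_box_Int_halfspace_lt[OF _ i] ne(1)])
    fix \<C> assume C: "box_family \<C>" "\<Union>\<C> = \<Union>\<A> \<inter> ?lt s"
      "\<And>P. P \<in> \<A> \<Longrightarrow> P \<inter> ?lt s = {} \<Longrightarrow> card \<C> < card \<A>"
    have "Q' \<inter> ?lt s = {}" using Q(6) by fastforce
    then show thesis using C Q(2) that by blast
  qed
  obtain \<A>2 where A2: "box_family \<A>2" "\<Union>\<A>2 = \<Union>\<A> \<inter> ?gt s" "card \<A>2 < card \<A>"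
  proof (rule box_family_restrict[OF \<A> open_box_Int_halfspace_gt[OF _ i] ne(2)])
    fix \<C> assume C: "box_family \<C>" "\<Union>\<C> = \<Union>\<A> \<inter> ?gt s"
      "\<And>P. P \<in> \<A> \<Longrightarrow> P \<inter> ?gt s = {} \<Longrightarrow> card \<C> < card \<A>"
    have "Q \<inter> ?gt s = {}" using Q(5) by fastforce
    then show thesis using C Q(1) that by blast
  qed
  define \<alpha> where "\<alpha> = measure lborel (\<Union>\<A> \<inter> ?lt s) / measure lborel (\<Union>\<A>)"
  have Aa: "measure lborel (\<Union>\<A> \<inter> ?lt s) = \<alpha> * measure lborel (\<Union>\<A>)"
    using fA(6) by (simp add: \<alpha>_def)
  \<comment> \<open>Each half contains a whole box, so the ratio is strictly between 0 and 1, and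
    both halves of \<open>\<Union>\<B>\<close> will have positive volume too.\<close>
  have "measure lborel (\<Union>\<A> \<inter> ?lt s) > 0" "measure lborel (\<Union>\<A> \<inter> ?gt s) > 0"
    using box_family_properties(6) A1 A2 by metis+
  then have \<alpha>: "0 < \<alpha>" "\<alpha> < 1"
    using fA(6) measure_halfspaces[OF fA(1,2) i, of s] by (auto simp: \<alpha>_def)
  obtain t where Ba: "measure lborel (\<Union>\<B> \<inter> ?lt t) = \<alpha> * measure lborel (\<Union>\<B>)"
    using halfspace_of_measure[OF \<B> i, of "\<alpha> * measure lborel (\<Union>\<B>)"] \<alpha> fB(6)
    by (auto simp: mult_le_cancel_right1)
  have "measure lborel (\<Union>\<B> \<inter> ?gt t) = (1 - \<alpha>) * measure lborel (\<Union>\<B>)"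
    using Ba measure_halfspaces[OF fB(1,2) i, of t] by (simp add: algebra_simps)
  then have "measure lborel (\<Union>\<B> \<inter> ?lt t) > 0" "measure lborel (\<Union>\<B> \<inter> ?gt t) > 0"
    using \<alpha> fB(6) Ba by auto
  then have neB: "\<Union>\<B> \<inter> ?lt t \<noteq> {}" "\<Union>\<B> \<inter> ?gt t \<noteq> {}" by force+
  obtain \<B>1 where B1: "box_family \<B>1" "\<Union>\<B>1 = \<Union>\<B> \<inter> ?lt t" "card \<B>1 \<le> card \<B>"
    by (rule box_family_restrict[OF \<B> open_box_Int_halfspace_lt[OF _ i] neB(1)])
  obtain \<B>2 where B2: "box_family \<B>2" "\<Union>\<B>2 = \<Union>\<B> \<inter> ?gt t" "card \<B>2 \<le> card \<B>"
    by (rule box_family_restrict[OF \<B> open_box_Int_halfspace_gt[OF _ i] neB(2)])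
  obtain R1 R2 :: "('a set \<times> 'a set) set"
    where "matching (\<Union>\<A>1) (\<Union>\<B>1) R1" "matching (\<Union>\<A>2) (\<Union>\<B>2) R2"
    using IH[OF A1(1) B1(1) A1(3) B1(3)] IH[OF A2(1) B2(1) A2(3) B2(3)] by blast
  then have "matching (\<Union>\<A>) (\<Union>\<B>) (R1 \<union> R2)"
    unfolding A1(2) A2(2) B1(2) B2(2)
    by (rule matching_halfspaces[OF _ _ fA(1,2) fB(1,2) i \<alpha> Aa Ba])
  then show ?thesis by blast
qed

text \<open>Induction on the total number of boxes: a family with at least two boxes is split, after
  a swap if it is the second one, and two single boxes are paired with each other.\<close>

lemma matching_exists:
  fixes \<A> \<B> :: "'a::euclidean_space set set"
  assumes "box_family \<A>" "box_family \<B>"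
  shows "\<exists>R. matching (\<Union>\<A>) (\<Union>\<B>) R"
  using assms
proof (induction "card \<A> + card \<B>" arbitrary: \<A> \<B> rule: less_induct)
  case less
  obtain P0 Q0 where "P0 \<in> \<A>" "Q0 \<in> \<B>" using less.prems by (auto simp: box_family_def)
  then have "\<A> = {P0} \<or> (\<exists>P'\<in>\<A>. P' \<noteq> P0)" "\<B> = {Q0} \<or> (\<exists>Q'\<in>\<B>. Q' \<noteq> Q0)" by blast+
  then consider P P' where "P \<in> \<A>" "P' \<in> \<A>" "P \<noteq> P'" | Q Q' where "Q \<in> \<B>" "Q' \<in> \<B>" "Q \<noteq> Q'"
    | P Q where "\<A> = {P}" "\<B> = {Q}"
    using \<open>P0 \<in> \<A>\<close> \<open>Q0 \<in> \<B>\<close> by metis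
  then show ?case
  proof cases
    case 1
    show ?thesis
      by (rule matching_split[OF less.prems 1]) (use less.hyps in auto)
  next
    case 2
    have "\<exists>R. matching (\<Union>\<B>) (\<Union>\<A>) R"
    proof (rule matching_split[OF less.prems(2,1) 2])
      fix \<C> \<D> :: "'a set set"
      assume "box_family \<C>" "box_family \<D>" "card \<C> < card \<B>" "card \<D> \<le> card \<A>"
      then have "\<exists>R. matching (\<Union>\<D>) (\<Union>\<C>) R" using less.hyps[of \<D> \<C>] by auto
      then show "\<exists>R. matching (\<Union>\<C>) (\<Union>\<D>) R" using matching_swap by blast
    qed
    then show ?thesis using matching_swap by blast
  next
    case 3
    then have "matching (\<Union>\<A>) (\<Union>\<B>) {(P, Q)}"
      using less.prems by (auto simp: matching_def box_family_def)
    then show ?thesis by blast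
  qed
qed

section \<open>Interpolation between boxes and its Jacobian\<close>

definition interp :: "real \<Rightarrow> 'a::real_vector set \<Rightarrow> 'a set \<Rightarrow> 'a set" where
  "interp t P Q = {(1 - t) *\<^sub>R x + t *\<^sub>R y | x y. x \<in> P \<and> y \<in> Q}"

lemma open_interp:
  fixes P :: "'a::real_normed_vector set"
  assumes "open P" "t < 1"
  shows "open (interp t P Q)"
proof -
  have "interp t P Q = (\<Union>y\<in>Q. (\<lambda>x. t *\<^sub>R y + (1 - t) *\<^sub>R x) ` P)"
    unfolding interp_def by (auto simp: add.commute)
  then show ?thesis using assms by (auto intro!: open_affinity)
qed

text \<open>Interpolating the heights of the two cuts gives a hyperplane, at height
  \<open>(1 - t) * s + t * r\<close>, strictly between the two interpolated sets.\<close>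

lemma interp_disjoint:
  assumes "pair_separated p q" "0 < t" "t < 1"
  shows "interp t (fst p) (snd p) \<inter> interp t (fst q) (snd q) = {}"
proof -
  obtain i s r where h: "\<forall>x\<in>fst p. x \<bullet> i < s" "\<forall>y\<in>snd p. y \<bullet> i < r"
      "\<forall>x\<in>fst q. s < x \<bullet> i" "\<forall>y\<in>snd q. r < y \<bullet> i"
    using assms(1) unfolding pair_separated_def by blast
  have "z \<bullet> i < (1 - t) * s + t * r" if "z \<in> interp t (fst p) (snd p)" for z
    using that h(1,2) assms(2,3) unfolding interp_def
    by (auto simp: inner_add_left intro!: add_strict_mono)
  moreover have "(1 - t) * s + t * r < z \<bullet> i" if "z \<in> interp t (fst q) (snd q)" for z
    using that h(3,4) assms(2,3) unfolding interp_def
    by (auto simp: inner_add_left intro!: add_strict_mono)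
  ultimately show ?thesis by fastforce
qed

text \<open>The weighted inequality of arithmetic and geometric means for 1 and \<open>l\<close>,
  from convexity of \<open>exp\<close> between 0 and \<open>ln l\<close>.\<close>

lemma powr_le_affine:
  fixes l t :: real
  assumes "0 < l" "0 \<le> t" "t \<le> 1"
  shows "l powr t \<le> (1 - t) + t * l"
proof -
  have "exp ((1 - t) *\<^sub>R 0 + t *\<^sub>R ln l) \<le> (1 - t) * exp 0 + t * exp (ln l)"
    by (rule convex_onD[OF exp_convex]) (use assms in auto)
  then show ?thesis using assms by (simp add: powr_def)
qed

text \<open>Factor by factor, the product of affine terms dominates \<open>?L powr t\<close>, and
  this power lies between 1 and \<open>?L\<close>.\<close>

lemma prod_affine_ge_min:
  fixes l :: "'i \<Rightarrow> real"
  assumes "finite I" "\<And>i. i \<in> I \<Longrightarrow> 0 < l i" "0 \<le> t" "t \<le> 1"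
  shows "min 1 (\<Prod>i\<in>I. l i) \<le> (\<Prod>i\<in>I. (1 - t) + t * l i)"
proof -
  let ?L = "\<Prod>i\<in>I. l i"
  have L: "?L > 0" using assms by (auto intro: prod_pos)
  have "min 1 ?L \<le> ?L powr t"
  proof (cases "?L \<le> 1")
    case True
    have "?L powr 1 \<le> ?L powr t" using assms True L by (intro powr_mono') auto
    then show ?thesis using L by simp
  next
    case False
    then show ?thesis using assms(3) by (auto simp: ge_one_powr_ge_zero min_le_iff_disj)
  qed
  also have "\<dots> = (\<Prod>i\<in>I. l i powr t)"
    by (rule prod_powr_distrib)
  also have "\<dots> \<le> (\<Prod>i\<in>I. (1 - t) + t * l i)"
    using assms by (intro prod_mono) (auto intro: powr_le_affine)
  finally show ?thesis .
qed

text \<open>Change of variables for a diagonal affine map; positive entries allow the absolute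
  values in the Jacobian to be dropped.\<close>

lemma nn_integral_affine_euclidean:
  fixes c :: "'a::euclidean_space \<Rightarrow> real"
  assumes "\<And>j. j \<in> Basis \<Longrightarrow> 0 < c j" "f \<in> borel_measurable borel"
  shows "(\<integral>\<^sup>+x. f x \<partial>lborel) = ennreal (\<Prod>j\<in>Basis. c j) * (\<integral>\<^sup>+x. f (v + (\<Sum>j\<in>Basis. (c j * (x \<bullet> j)) *\<^sub>R j)) \<partial>lborel)"
proof -
  have "\<And>j. j \<in> Basis \<Longrightarrow> c j \<noteq> 0" using assms(1) by force
  note * = lborel_affine_euclidean[of c v, OF this]
  have abs: "(\<Prod>j\<in>Basis. \<bar>c j\<bar>) = (\<Prod>j\<in>Basis. c j)"
    using assms(1) by (intro prod.cong) (auto simp: abs_of_pos)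
  have meas: "(\<lambda>x. v + (\<Sum>j\<in>Basis. (c j * (x \<bullet> j)) *\<^sub>R j)) \<in> borel \<rightarrow>\<^sub>M borel"
    by (intro borel_measurable_continuous_onI continuous_intros)
  have "(\<integral>\<^sup>+x. f x \<partial>lborel) = (\<integral>\<^sup>+x. f x \<partial>density (distr lborel borel (\<lambda>x. v + (\<Sum>j\<in>Basis. (c j * (x \<bullet> j)) *\<^sub>R j)))
      (\<lambda>_. ennreal (\<Prod>j\<in>Basis. \<bar>c j\<bar>)))"
    by (subst *) auto
  also have "\<dots> = ennreal (\<Prod>j\<in>Basis. c j) * (\<integral>\<^sup>+x. f (v + (\<Sum>j\<in>Basis. (c j * (x \<bullet> j)) *\<^sub>R j)) \<partial>lborel)"
    using assms(2) meas unfolding abs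
    by (subst nn_integral_density) (auto simp: nn_integral_distr nn_integral_cmult)
  finally show ?thesis .
qed

text \<open>\<open>T\<close> rescales each coordinate affinely by the ratio \<open>l j\<close> of
  side lengths. Its interpolation with the identity is again diagonal, with entries
  \<open>(1 - t) + t * l j\<close>, so \<open>J t\<close> is their product and
  \<open>prod_affine_ge_min\<close> bounds it from below.\<close>

lemma open_box_affine_map:
  fixes P Q :: "'a::euclidean_space set"
  assumes "open_box P" "open_box Q"
  obtains T J where "continuous_on UNIV T" "T ` P \<subseteq> Q" "J 1 = measure lborel Q / measure lborel P"
    "\<And>t. 0 \<le> t \<Longrightarrow> t \<le> 1 \<Longrightarrow> min 1 (measure lborel Q / measure lborel P) \<le> J t"
    "\<And>t f. 0 \<le> t \<Longrightarrow> t \<le> 1 \<Longrightarrow> f \<in> borel_measurable borel \<Longrightarrow>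
       (\<integral>\<^sup>+x. f x \<partial>lborel) = ennreal (J t) * (\<integral>\<^sup>+x. f ((1 - t) *\<^sub>R x + t *\<^sub>R T x) \<partial>lborel)"
proof -
  obtain a b where P: "P = box a b" "\<And>j. j \<in> Basis \<Longrightarrow> a \<bullet> j < b \<bullet> j"
    using assms(1) unfolding open_box_def by (metis box_ne_empty(2))
  obtain c d where Q: "Q = box c d" "\<And>j. j \<in> Basis \<Longrightarrow> c \<bullet> j < d \<bullet> j"
    using assms(2) unfolding open_box_def by (metis box_ne_empty(2))
  define l where "l j = (d \<bullet> j - c \<bullet> j) / (b \<bullet> j - a \<bullet> j)" for j
  define v where "v = (\<Sum>j\<in>Basis. (c \<bullet> j - l j * (a \<bullet> j)) *\<^sub>R j)"
  define T where "T x = v + (\<Sum>j\<in>Basis. (l j * (x \<bullet> j)) *\<^sub>R j)" for x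
  define J where "J t = (\<Prod>j\<in>(Basis::'a set). (1 - t) + t * l j)" for t
  have l: "l j > 0" if "j \<in> Basis" for j using P(2)[OF that] Q(2)[OF that] by (simp add: l_def)
  have Tj: "T x \<bullet> j = c \<bullet> j + l j * (x \<bullet> j - a \<bullet> j)" if "j \<in> Basis" for x j
  proof -
    have "v \<bullet> j = c \<bullet> j - l j * (a \<bullet> j)" using that by (simp add: v_def)
    then show ?thesis using that by (simp add: T_def inner_add_left algebra_simps)
  qed
  have vol: "measure lborel Q / measure lborel P = (\<Prod>j\<in>Basis. l j)"
    using P Q by (auto simp: measure_lborel_box_eq less_imp_le l_def inner_diff_left prod_dividef)
  show thesis
  proof (rule that)
    show "continuous_on UNIV T" unfolding T_def by (intro continuous_intros)
    show "T ` P \<subseteq> Q"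
    proof
      fix y assume "y \<in> T ` P"
      then obtain x where x: "x \<in> P" "y = T x" by blast
      have "c \<bullet> j < T x \<bullet> j \<and> T x \<bullet> j < d \<bullet> j" if j: "j \<in> Basis" for j
      proof -
        have *: "0 < x \<bullet> j - a \<bullet> j" "x \<bullet> j - a \<bullet> j < b \<bullet> j - a \<bullet> j" "0 < b \<bullet> j - a \<bullet> j"
          using x(1) j P by (auto simp: mem_box)
        have "0 < l j * (x \<bullet> j - a \<bullet> j)" using l[OF j] * by simp
        moreover have "l j * (x \<bullet> j - a \<bullet> j) < l j * (b \<bullet> j - a \<bullet> j)" using l[OF j] * by simp
        moreover have "l j * (b \<bullet> j - a \<bullet> j) = d \<bullet> j - c \<bullet> j" using * by (simp add: l_def)
        ultimately show ?thesis by (simp add: Tj[OF j])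
      qed
      then show "y \<in> Q" using x(2) by (auto simp: Q(1) mem_box)
    qed
    show "J 1 = measure lborel Q / measure lborel P" by (simp add: J_def vol)
    fix t :: real assume t: "0 \<le> t" "t \<le> 1"
    show "min 1 (measure lborel Q / measure lborel P) \<le> J t"
      unfolding J_def vol using l t by (intro prod_affine_ge_min) auto
    fix f :: "'a \<Rightarrow> ennreal" assume f: "f \<in> borel_measurable borel"
    have pos: "0 < (1 - t) + t * l j" if "j \<in> Basis" for j
      using l[OF that] t by (cases "t = 1") (auto intro: add_pos_nonneg)
    have "(1 - t) *\<^sub>R x + t *\<^sub>R T x = t *\<^sub>R v + (\<Sum>j\<in>Basis. (((1 - t) + t * l j) * (x \<bullet> j)) *\<^sub>R j)" for x
      by (rule euclidean_eqI, simp add: T_def inner_add_left, simp add: algebra_simps)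
    then show "(\<integral>\<^sup>+x. f x \<partial>lborel) = ennreal (J t) * (\<integral>\<^sup>+x. f ((1 - t) *\<^sub>R x + t *\<^sub>R T x) \<partial>lborel)"
      using nn_integral_affine_euclidean[OF pos f, where v = "t *\<^sub>R v"] unfolding J_def by simp
  qed
qed

section \<open>Counting crossings\<close>

text \<open>A point \<open>x\<close> of \<open>P\<close> with \<open>x \<in> A\<close> and
  \<open>T x \<in> B\<close> spends time at least \<open>\<delta>\<close> in \<open>C\<close> on its
  way to \<open>T x\<close>. Integrating over \<open>x\<close> and exchanging integrals gives a
  bound on the slices; the volumes of \<open>P - A\<close> and \<open>Q - B\<close> account for all
  other \<open>x\<close>. The function \<open>g\<close> is a minorant of the slice volume that is
  measurable in \<open>t\<close> because it is a partial integral.\<close>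

lemma open_box_pair_crossing:
  fixes A B C P Q :: "'a::euclidean_space set"
  assumes P: "open_box P" and Q: "open_box Q"
    and [measurable]: "A \<in> sets borel" "B \<in> sets borel" "C \<in> sets borel"
    and \<delta>: "0 \<le> \<delta>"
    and cross: "\<And>x y. x \<in> A \<Longrightarrow> y \<in> B \<Longrightarrow>
      \<exists>u v. 0 \<le> u \<and> v \<le> 1 \<and> \<delta> \<le> v - u \<and> (\<forall>t\<in>{u<..<v}. (1 - t) *\<^sub>R x + t *\<^sub>R y \<in> C)"
  defines "m \<equiv> min 1 (measure lborel Q / measure lborel P)"
  obtains g :: "real \<Rightarrow> ennreal" where "g \<in> borel_measurable lborel"
    "\<And>t. 0 < t \<Longrightarrow> t < 1 \<Longrightarrow> g t \<le> emeasure lborel (C \<inter> interp t P Q)"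
    "ennreal (\<delta> * (m * measure lborel P - measure lborel (P - A) - measure lborel (Q - B)))
       \<le> (\<integral>\<^sup>+t\<in>{0<..<1}. g t \<partial>lborel)"
proof -
  note fP = open_box_properties[OF P] and fQ = open_box_properties[OF Q]
  note [measurable] = fP(1) fQ(1)
  define l where "l = measure lborel Q / measure lborel P"
  have l: "l > 0" using fP(3) fQ(3) by (simp add: l_def)
  have m: "0 < m" "m \<le> 1" "m \<le> l" using l by (auto simp: m_def l_def)
  obtain T J where T: "continuous_on UNIV T" "T ` P \<subseteq> Q" and J1: "J 1 = l"
    and J: "\<And>t. 0 \<le> t \<Longrightarrow> t \<le> 1 \<Longrightarrow> m \<le> J t"
      "\<And>t f. 0 \<le> t \<Longrightarrow> t \<le> 1 \<Longrightarrow> f \<in> borel_measurable borel \<Longrightarrow>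
       (\<integral>\<^sup>+x. f x \<partial>lborel) = ennreal (J t) * (\<integral>\<^sup>+x. f ((1 - t) *\<^sub>R x + t *\<^sub>R T x) \<partial>lborel)"
    unfolding m_def l_def using open_box_affine_map[OF P Q] by blast
  have T_meas[measurable]: "T \<in> borel \<rightarrow>\<^sub>M borel" using T(1) by (rule borel_measurable_continuous_onI)
  define h :: "real \<Rightarrow> 'a \<Rightarrow> ennreal" where
    "h t x = indicator C ((1 - t) *\<^sub>R x + t *\<^sub>R T x) * indicator P x" for t x
  have h_meas[measurable]: "(\<lambda>(t, x). h t x) \<in> borel_measurable (lborel \<Otimes>\<^sub>M lborel)"
    unfolding h_def by measurable
  \<comment> \<open>\<open>m\<close> is a lower bound for \<open>J t\<close> independent of
    \<open>t\<close>, which keeps \<open>g t\<close> below the volume of the slice.\<close>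
  define g where "g t = ennreal m * (\<integral>\<^sup>+x. h t x \<partial>lborel)" for t
  define E where "E = {x \<in> P. x \<in> A \<and> T x \<in> B}"
  have E_meas[measurable]: "E \<in> sets borel" unfolding E_def by measurable
  show thesis
  proof (rule that)
    show "g \<in> borel_measurable lborel" unfolding g_def by measurable
    show "g t \<le> emeasure lborel (C \<inter> interp t P Q)" if t: "0 < t" "t < 1" for t
    proof -
      have o: "interp t P Q \<in> sets borel" using open_interp[OF fP(5) t(2)] by simp
      have "h t x \<le> indicator (C \<inter> interp t P Q) ((1 - t) *\<^sub>R x + t *\<^sub>R T x)" for x
        using T(2) unfolding h_def interp_def by (auto simp: indicator_def)
      then have "(\<integral>\<^sup>+x. h t x \<partial>lborel) \<le> (\<integral>\<^sup>+x. indicator (C \<inter> interp t P Q) ((1 - t) *\<^sub>R x + t *\<^sub>R T x) \<partial>lborel)"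
        by (intro nn_integral_mono)
      then have "g t \<le> ennreal (J t) * (\<integral>\<^sup>+x. indicator (C \<inter> interp t P Q) ((1 - t) *\<^sub>R x + t *\<^sub>R T x) \<partial>lborel)"
        unfolding g_def using J(1)[of t] t by (intro mult_mono) (auto simp: ennreal_leI)
      also have "\<dots> = (\<integral>\<^sup>+x. indicator (C \<inter> interp t P Q) x \<partial>lborel)"
        using t o by (intro J(2)[symmetric]) auto
      finally show ?thesis using o by simp
    qed
    \<comment> \<open>For a point of \<open>E\<close> the times spent in \<open>C\<close> contain an
      interval of length at least \<open>\<delta>\<close>.\<close>
    have line: "ennreal \<delta> * indicator E x \<le> (\<integral>\<^sup>+t. h t x * indicator {0<..<1} t \<partial>lborel)" for x
    proof (cases "x \<in> E")
      case True
      then obtain u v where uv: "0 \<le> u" "v \<le> 1" "\<delta> \<le> v - u"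
        "\<And>t. t \<in> {u<..<v} \<Longrightarrow> (1 - t) *\<^sub>R x + t *\<^sub>R T x \<in> C"
        using cross[of x "T x"] unfolding E_def by auto
      have "ennreal \<delta> * indicator E x \<le> ennreal (v - u)"
        using True uv(3) by (simp add: ennreal_leI)
      also have "\<dots> = (\<integral>\<^sup>+t. indicator {u<..<v} t \<partial>lborel)"
        using uv(3) \<delta> by simp
      also have "\<dots> \<le> (\<integral>\<^sup>+t. h t x * indicator {0<..<1} t \<partial>lborel)"
        using True uv by (intro nn_integral_mono) (auto simp: h_def E_def indicator_def)
      finally show ?thesis .
    qed simp
    have "ennreal (m * \<delta>) * emeasure lborel E = ennreal m * (\<integral>\<^sup>+x. ennreal \<delta> * indicator E x \<partial>lborel)"
      using \<delta> m by (simp add: nn_integral_cmult_indicator ennreal_mult mult.assoc)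
    also have "\<dots> \<le> ennreal m * (\<integral>\<^sup>+x. (\<integral>\<^sup>+t. h t x * indicator {0<..<1} t \<partial>lborel) \<partial>lborel)"
      by (intro mult_left_mono nn_integral_mono line) auto
    \<comment> \<open>Tonelli: crossing times summed over points become slice contributions summed
      over times.\<close>
    also have "\<dots> = ennreal m * (\<integral>\<^sup>+t. (\<integral>\<^sup>+x. h t x * indicator {0<..<1} t \<partial>lborel) \<partial>lborel)"
      by (subst lborel_pair.Fubini') (auto simp: h_def)
    also have "\<dots> = (\<integral>\<^sup>+t\<in>{0<..<1}. g t \<partial>lborel)"
      unfolding g_def by (simp add: nn_integral_multc nn_integral_cmult mult.assoc)
    finally have low: "ennreal (m * \<delta>) * emeasure lborel E \<le> (\<integral>\<^sup>+t\<in>{0<..<1}. g t \<partial>lborel)" .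
    have finP: "X \<in> fmeasurable lborel" if "X \<subseteq> P" "X \<in> sets borel" for X
      using fmeasurableI2[of P lborel X] that fP(1,2) by (auto simp: fmeasurable_def)
    have finQ: "Q - B \<in> fmeasurable lborel"
      using fmeasurableI2[of Q lborel "Q - B"] fQ(1,2) by (auto simp: fmeasurable_def)
    define F where "F = {x \<in> P. T x \<in> Q - B}"
    have F_meas[measurable]: "F \<in> sets borel" unfolding F_def by measurable
    \<comment> \<open>\<open>J 1 = l\<close> is the Jacobian of \<open>T\<close> itself, and
      \<open>T\<close> maps \<open>F\<close> into \<open>Q - B\<close>.\<close>
    have F: "l * measure lborel F \<le> measure lborel (Q - B)"
    proof -
      have "ennreal l * emeasure lborel F = ennreal l * (\<integral>\<^sup>+x. indicator F x \<partial>lborel)" by simp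
      also have "\<dots> \<le> ennreal l * (\<integral>\<^sup>+x. indicator (Q - B) (T x) \<partial>lborel)"
        by (intro mult_left_mono nn_integral_mono) (auto simp: F_def indicator_def)
      also have "\<dots> = (\<integral>\<^sup>+x. indicator (Q - B) x \<partial>lborel)"
        using J(2)[of 1 "indicator (Q - B)"] by (simp add: J1)
      also have "\<dots> = emeasure lborel (Q - B)" by simp
      finally have "ennreal (l * measure lborel F) \<le> ennreal (measure lborel (Q - B))"
        using finQ finP[of F] l F_meas
        by (simp add: emeasure_eq_measure2 ennreal_mult F_def)
      then show ?thesis by simp
    qed
    have "P \<subseteq> E \<union> (P - A) \<union> F" using T(2) unfolding E_def F_def by auto
    moreover have fms: "E \<in> fmeasurable lborel" "P - A \<in> fmeasurable lborel" "F \<in> fmeasurable lborel"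
      by (auto intro!: finP simp: E_def F_def)
    ultimately have "measure lborel P \<le> measure lborel (E \<union> (P - A) \<union> F)"
      by (intro measure_mono_fmeasurable) auto
    also have "\<dots> \<le> measure lborel E + measure lborel (P - A) + measure lborel F"
      using measure_Un_le[of "E \<union> (P - A)" lborel F] measure_Un_le[of E lborel "P - A"] by auto
    finally have "m * measure lborel P \<le> m * (measure lborel E + measure lborel (P - A) + measure lborel F)"
      using m by simp
    \<comment> \<open>\<open>m \<le> 1\<close> removes the factor on \<open>P - A\<close>, and
      \<open>m \<le> l\<close> lets the bound on \<open>F\<close> apply.\<close>
    also have "\<dots> \<le> m * measure lborel E + measure lborel (P - A) + measure lborel (Q - B)"
    proof -
      have "m * measure lborel (P - A) \<le> 1 * measure lborel (P - A)" using m by (intro mult_right_mono) auto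
      moreover have "m * measure lborel F \<le> l * measure lborel F" using m by (intro mult_right_mono) auto
      ultimately show ?thesis using F by (simp add: algebra_simps)
    qed
    finally have "\<delta> * (m * measure lborel P - measure lborel (P - A) - measure lborel (Q - B)) \<le> \<delta> * (m * measure lborel E)"
      using \<delta> by (intro mult_left_mono) auto
    also have "\<dots> = m * \<delta> * measure lborel E" by simp
    finally have "ennreal (\<delta> * (m * measure lborel P - measure lborel (P - A) - measure lborel (Q - B)))
        \<le> ennreal (m * \<delta>) * emeasure lborel E"
      using fms(1) \<delta> m by (simp add: emeasure_eq_measure2 ennreal_mult[symmetric] ennreal_leI)
    also note low
    finally show "ennreal (\<delta> * (m * measure lborel P - measure lborel (P - A) - measure lborel (Q - B)))
       \<le> (\<integral>\<^sup>+t\<in>{0<..<1}. g t \<partial>lborel)" .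
  qed
qed

text \<open>\<open>ennreal\<close> sends negative reals to 0, so truncating term by term can only
  enlarge the sum. This is for the weights of single pairs, whose sign is not controlled.\<close>

lemma ennreal_sum_le:
  fixes f :: "'i \<Rightarrow> real"
  shows "ennreal (\<Sum>i\<in>I. f i) \<le> (\<Sum>i\<in>I. ennreal (f i))"
proof -
  have "ennreal (\<Sum>i\<in>I. f i) \<le> ennreal (\<Sum>i\<in>I. max 0 (f i))"
    by (intro ennreal_leI sum_mono) auto
  also have "\<dots> = (\<Sum>i\<in>I. ennreal (f i))"
    unfolding sum_ennreal[symmetric, OF max.cobounded1]
    by (intro sum.cong) (auto simp: max_def ennreal_neg)
  finally show ?thesis .
qed

lemma sum_measure_disjoint_le:
  assumes "finite I" "disjoint_family_on F I" "\<And>i. i \<in> I \<Longrightarrow> F i \<in> sets M"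
    "\<And>i. i \<in> I \<Longrightarrow> F i \<subseteq> X" "X \<in> fmeasurable M"
  shows "(\<Sum>i\<in>I. measure M (F i)) \<le> measure M X"
proof -
  have fm: "F i \<in> fmeasurable M" if "i \<in> I" for i
    using fmeasurableI2[OF assms(5)] assms(3,4) that by blast
  have "(\<Sum>i\<in>I. measure M (F i)) = measure M (\<Union>i\<in>I. F i)"
    by (rule measure_finite_Union[symmetric]) (use assms fmeasurableD2[OF fm] in auto)
  also have "\<dots> \<le> measure M X"
    by (rule measure_mono_fmeasurable) (use assms in auto)
  finally show ?thesis .
qed

text \<open>For each \<open>t\<close> the interpolated boxes of different pairs are disjoint, so the
  slices found for single pairs add up inside \<open>C\<close>. Integrating over \<open>t\<close> in
  a unit interval leaves the volume of \<open>C\<close> as the bound.\<close>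

lemma matching_crossing:
  fixes A B C A' B' :: "'a::euclidean_space set"
  assumes R: "matching A' B' R"
    and A': "A' \<in> fmeasurable lborel" "measure lborel A' > 0" and B': "B' \<in> fmeasurable lborel"
    and meas: "A \<in> sets borel" "B \<in> sets borel" "C \<in> sets borel" and C: "emeasure lborel C < \<infinity>"
    and \<delta>: "0 \<le> \<delta>"
    and cross: "\<And>x y. x \<in> A \<Longrightarrow> y \<in> B \<Longrightarrow>
      \<exists>u v. 0 \<le> u \<and> v \<le> 1 \<and> \<delta> \<le> v - u \<and> (\<forall>t\<in>{u<..<v}. (1 - t) *\<^sub>R x + t *\<^sub>R y \<in> C)"
  shows "\<delta> * (min (measure lborel A') (measure lborel B') - measure lborel (A' - A) - measure lborel (B' - B))
    \<le> measure lborel C"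
proof -
  define m where "m = min 1 (measure lborel B' / measure lborel A')"
  define w where "w p = m * measure lborel (fst p) - measure lborel (fst p - A) - measure lborel (snd p - B)" for p
  have fin: "finite R" using R by (simp add: matching_def)
  have box: "open_box (fst p)" "open_box (snd p)" "fst p \<subseteq> A'" "snd p \<subseteq> B'"
      "measure lborel (snd p) * measure lborel A' = measure lborel (fst p) * measure lborel B'" if "p \<in> R" for p
    using R that by (auto simp: matching_def split_beta dest!: bspec)
  have dis: "pair_separated p q \<or> pair_separated q p" if "p \<in> R" "q \<in> R" "p \<noteq> q" for p q
    using R that by (auto simp: matching_def pairwise_def)
  have "\<exists>g. g \<in> borel_measurable lborel
      \<and> (\<forall>t. 0 < t \<longrightarrow> t < 1 \<longrightarrow> g t \<le> emeasure lborel (C \<inter> interp t (fst p) (snd p)))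
      \<and> ennreal (\<delta> * w p) \<le> (\<integral>\<^sup>+t\<in>{0<..<1}. g t \<partial>lborel)" if p: "p \<in> R" for p
  proof -
    \<comment> \<open>All pairs share one volume ratio, so the constant of
      \<open>open_box_pair_crossing\<close> is \<open>m\<close> for every pair.\<close>
    have "measure lborel (snd p) / measure lborel (fst p) = measure lborel B' / measure lborel A'"
      using box(5)[OF p] open_box_properties(3)[OF box(1)[OF p]] A'(2) by (simp add: field_simps)
    then have w: "w p = min 1 (measure lborel (snd p) / measure lborel (fst p)) * measure lborel (fst p)
        - measure lborel (fst p - A) - measure lborel (snd p - B)"
      by (simp add: w_def m_def)
    show ?thesis
      by (rule open_box_pair_crossing[OF box(1,2)[OF p] meas \<delta> cross]) (assumption+, unfold w, blast)
  qed
  then have "\<exists>g. \<forall>p\<in>R. g p \<in> borel_measurable lborel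
      \<and> (\<forall>t. 0 < t \<longrightarrow> t < 1 \<longrightarrow> g p t \<le> emeasure lborel (C \<inter> interp t (fst p) (snd p)))
      \<and> ennreal (\<delta> * w p) \<le> (\<integral>\<^sup>+t\<in>{0<..<1}. g p t \<partial>lborel)"
    by (intro bchoice ballI)
  then obtain g where g: "\<And>p. p \<in> R \<Longrightarrow> g p \<in> borel_measurable lborel"
      "\<And>p t. p \<in> R \<Longrightarrow> 0 < t \<Longrightarrow> t < 1 \<Longrightarrow> g p t \<le> emeasure lborel (C \<inter> interp t (fst p) (snd p))"
      "\<And>p. p \<in> R \<Longrightarrow> ennreal (\<delta> * w p) \<le> (\<integral>\<^sup>+t\<in>{0<..<1}. g p t \<partial>lborel)"
    by auto
  have slice: "(\<Sum>p\<in>R. g p t) \<le> emeasure lborel C" if t: "0 < t" "t < 1" for t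
  proof -
    have *: "C \<inter> interp t (fst p) (snd p) \<in> sets lborel" if "p \<in> R" for p
      using open_interp[OF open_box_properties(5)[OF box(1)[OF that]] t(2)] meas(3) by auto
    have "(\<Sum>p\<in>R. g p t) \<le> (\<Sum>p\<in>R. emeasure lborel (C \<inter> interp t (fst p) (snd p)))"
      using g(2) t by (intro sum_mono)
    also have "\<dots> = emeasure lborel (\<Union>p\<in>R. C \<inter> interp t (fst p) (snd p))"
    proof (rule sum_emeasure)
      show "disjoint_family_on (\<lambda>p. C \<inter> interp t (fst p) (snd p)) R"
        unfolding disjoint_family_on_def
      proof (intro ballI impI)
        fix p q assume "p \<in> R" "q \<in> R" "p \<noteq> q"
        then have "interp t (fst p) (snd p) \<inter> interp t (fst q) (snd q) = {}"
          using dis[of p q] interp_disjoint[OF _ t, of p q] interp_disjoint[OF _ t, of q p] by auto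
        then show "(C \<inter> interp t (fst p) (snd p)) \<inter> (C \<inter> interp t (fst q) (snd q)) = {}" by blast
      qed
    qed (use * fin in auto)
    also have "\<dots> \<le> emeasure lborel C" using meas(3) by (intro emeasure_mono) auto
    finally show ?thesis .
  qed
  have "ennreal (\<delta> * (\<Sum>p\<in>R. w p)) \<le> (\<Sum>p\<in>R. ennreal (\<delta> * w p))"
    by (simp add: sum_distrib_left ennreal_sum_le)
  also have "\<dots> \<le> (\<Sum>p\<in>R. \<integral>\<^sup>+t\<in>{0<..<1}. g p t \<partial>lborel)"
    using g(3) by (intro sum_mono)
  also have "\<dots> = (\<integral>\<^sup>+t\<in>{0<..<1}. (\<Sum>p\<in>R. g p t) \<partial>lborel)"
    using g(1) by (subst nn_integral_sum[symmetric]) (auto simp: sum_distrib_right)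
  also have "\<dots> \<le> (\<integral>\<^sup>+t\<in>{0<..<1::real}. emeasure lborel C \<partial>lborel)"
    using slice by (intro nn_integral_mono) (auto simp: indicator_def)
  also have "\<dots> = emeasure lborel C" by (simp add: nn_integral_cmult_indicator)
  finally have "ennreal (\<delta> * (\<Sum>p\<in>R. w p)) \<le> ennreal (measure lborel C)"
    using C by (simp add: emeasure_eq_ennreal_measure)
  then have le: "\<delta> * (\<Sum>p\<in>R. w p) \<le> measure lborel C" by simp
  \<comment> \<open>Separation also makes the boxes disjoint within each component, so the defects
    add up inside \<open>A' - A\<close> and \<open>B' - B\<close>.\<close>
  have disj: "fst p \<inter> fst q = {}" "snd p \<inter> snd q = {}" if "p \<in> R" "q \<in> R" "p \<noteq> q" for p q
    using dis[OF that] unfolding pair_separated_def disjoint_iff by (metis less_asym)+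
  have "(\<Sum>p\<in>R. measure lborel (fst p - A)) \<le> measure lborel (A' - A)"
  proof (rule sum_measure_disjoint_le[OF fin])
    show "disjoint_family_on (\<lambda>p. fst p - A) R"
      unfolding disjoint_family_on_def
    proof (intro ballI impI)
      fix p q assume "p \<in> R" "q \<in> R" "p \<noteq> q"
      then show "(fst p - A) \<inter> (fst q - A) = {}" using disj(1)[of p q] by blast
    qed
    show "A' - A \<in> fmeasurable lborel" using A'(1) meas(1) by (simp add: fmeasurable_Diff)
    show "fst p - A \<in> sets lborel" if "p \<in> R" for p
      using open_box_properties(1)[OF box(1)[OF that]] meas(1) by simp
    show "fst p - A \<subseteq> A' - A" if "p \<in> R" for p
      using box(3)[OF that] by blast
  qed
  moreover have "(\<Sum>p\<in>R. measure lborel (snd p - B)) \<le> measure lborel (B' - B)"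
  proof (rule sum_measure_disjoint_le[OF fin])
    show "disjoint_family_on (\<lambda>p. snd p - B) R"
      unfolding disjoint_family_on_def
    proof (intro ballI impI)
      fix p q assume "p \<in> R" "q \<in> R" "p \<noteq> q"
      then show "(snd p - B) \<inter> (snd q - B) = {}" using disj(2)[of p q] by blast
    qed
    show "B' - B \<in> fmeasurable lborel" using B' meas(2) by (simp add: fmeasurable_Diff)
    show "snd p - B \<in> sets lborel" if "p \<in> R" for p
      using open_box_properties(1)[OF box(2)[OF that]] meas(2) by simp
    show "snd p - B \<subseteq> B' - B" if "p \<in> R" for p
      using box(4)[OF that] by blast
  qed
  moreover have "(\<Sum>p\<in>R. measure lborel (fst p)) = measure lborel A'"
    using R by (simp add: matching_def split_beta)
  \<comment> \<open>The minimum of the two volumes arises here, as the common factor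
    \<open>m\<close> applied to the full volume of \<open>A'\<close>.\<close>
  moreover have "m * measure lborel A' = min (measure lborel A') (measure lborel B')"
    using A'(2) by (auto simp: m_def min_def field_simps)
  ultimately have "min (measure lborel A') (measure lborel B') - measure lborel (A' - A) - measure lborel (B' - B) \<le> (\<Sum>p\<in>R. w p)"
    unfolding w_def by (simp add: sum_subtractf sum_distrib_left[symmetric])
  then show ?thesis using le mult_left_mono[OF _ \<delta>] by (meson order_trans)
qed

section \<open>Approximation by boxes\<close>

text \<open>Cover \<open>A\<close> by countably many closed boxes with disjoint interiors and excess
  volume at most \<open>e\<close>, keep finitely many at a loss below \<open>e\<close>, and pass to
  interiors, which loses only a null set.\<close>

lemma box_family_approx:
  fixes A :: "'a::euclidean_space set"
  assumes A: "A \<in> lmeasurable" "bounded A" and e: "0 < e" "e < measure lebesgue A"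
  obtains \<A> where "box_family \<A>" "measure lebesgue (\<Union>\<A> - A) \<le> e"
    "measure lebesgue A - e \<le> measure lebesgue (\<Union>\<A>)"
proof -
  obtain a where a: "A \<subseteq> cbox (- a) a" using bounded_subset_cbox_symmetric[OF A(2)] .
  obtain \<D> where D: "countable \<D>" "\<And>K. K \<in> \<D> \<Longrightarrow> \<exists>c d. K = cbox c d"
      "pairwise (\<lambda>A B. interior A \<inter> interior B = {}) \<D>"
      "A \<subseteq> \<Union>\<D>" "\<Union>\<D> \<in> lmeasurable" "measure lebesgue (\<Union>\<D>) \<le> measure lebesgue A + e"
    by (rule measurable_outer_intervals_bounded[OF A(1) a e(1)]) metis
  have Dm: "K \<in> lmeasurable" if "K \<in> \<D>" for K using D(2)[OF that] by auto
  obtain \<D>' where D': "\<D>' \<subseteq> \<D>" "finite \<D>'" "measure lebesgue (\<Union>\<D>) - e < measure lebesgue (\<Union>\<D>')"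
  proof (rule measure_countable_Union_approachable[OF D(1) e(1) Dm])
    show "measure lebesgue (\<Union>D') \<le> measure lebesgue (\<Union>\<D>)" if "D' \<subseteq> \<D>" "finite D'" for D'
      using that D(5) Dm by (intro measure_mono_fmeasurable) (auto intro!: fmeasurableD fmeasurable.finite_Union)
  qed
  \<comment> \<open>Degenerate boxes have empty interior and are discarded.\<close>
  define \<A> where "\<A> = interior ` \<D>' - {{}}"
  have fin: "finite \<A>" using D'(2) by (simp add: \<A>_def)
  have ob: "open_box P" if P: "P \<in> \<A>" for P
  proof -
    obtain K where K: "K \<in> \<D>" "P = interior K" "P \<noteq> {}" using P D'(1) unfolding \<A>_def by blast
    obtain c d where "K = cbox c d" using D(2)[OF K(1)] by blast
    then show ?thesis using K(2,3) unfolding open_box_def by (auto simp: interior_cbox)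
  qed
  have "disjoint \<A>"
    unfolding disjoint_def
  proof (intro ballI impI)
    fix P Q assume "P \<in> \<A>" "Q \<in> \<A>" "P \<noteq> Q"
    then obtain K L where "K \<in> \<D>" "L \<in> \<D>" "P = interior K" "Q = interior L" "K \<noteq> L"
      using D'(1) unfolding \<A>_def by blast
    then show "P \<inter> Q = {}" using D(3) by (simp add: pairwise_def)
  qed
  have sub: "\<Union>\<A> \<subseteq> \<Union>\<D>'" using interior_subset unfolding \<A>_def by fastforce
  have Am: "\<Union>\<A> \<in> lmeasurable"
    using fin ob open_box_properties(4,5) by (intro fmeasurable.finite_Union) (auto intro: lmeasurable_open)
  have D'm: "\<Union>\<D>' \<in> lmeasurable"
    using D'(1,2) Dm by (intro fmeasurable.finite_Union) auto
  have "measure lebesgue (\<Union>\<D>') \<le> measure lebesgue (\<Union>\<A>)"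
  proof -
    have "negligible (\<Union>K\<in>\<D>'. K - interior K)"
    proof (rule negligible_Union)
      show "negligible N" if N: "N \<in> (\<lambda>K. K - interior K) ` \<D>'" for N
      proof -
        obtain K where K: "K \<in> \<D>" "N = K - interior K" using N D'(1) by blast
        obtain c d where "K = cbox c d" using D(2)[OF K(1)] by blast
        then show ?thesis using K(2) negligible_frontier_interval by (simp add: interior_cbox)
      qed
    qed (use D'(2) in simp)
    then have "\<Union>\<A> \<union> (\<Union>K\<in>\<D>'. K - interior K) \<in> lmeasurable"
      "measure lebesgue (\<Union>\<A> \<union> (\<Union>K\<in>\<D>'. K - interior K)) = measure lebesgue (\<Union>\<A>)"
      using Am by (auto simp: negligible_imp_measurable measure_Un3_negligible negligible_iff_null_sets measure_Un_null_set fmeasurableD)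
    moreover have "\<Union>\<D>' \<subseteq> \<Union>\<A> \<union> (\<Union>K\<in>\<D>'. K - interior K)" unfolding \<A>_def by blast
    ultimately show ?thesis using D'm by (metis fmeasurableD measure_mono_fmeasurable)
  qed
  moreover have "measure lebesgue A \<le> measure lebesgue (\<Union>\<D>)"
    using D(4,5) A(1) by (intro measure_mono_fmeasurable) auto
  ultimately have low: "measure lebesgue A - e \<le> measure lebesgue (\<Union>\<A>)" using D'(3) by linarith
  have "measure lebesgue (\<Union>\<A> - A) \<le> measure lebesgue (\<Union>\<D> - A)"
    using sub D'(1) Am A(1) D(5) by (intro measure_mono_fmeasurable) (auto intro: fmeasurable.Diff fmeasurableD sets.Diff)
  also have "\<dots> = measure lebesgue (\<Union>\<D>) - measure lebesgue A"
    using D(4,5) A(1) by (intro measurable_measure_Diff) (auto intro: fmeasurableD)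
  also have "\<dots> \<le> e" using D(6) by simp
  finally have "measure lebesgue (\<Union>\<A> - A) \<le> e" .
  \<comment> \<open>Since \<open>e\<close> is below the volume of \<open>A\<close>, the union has
    positive volume.\<close>
  moreover have "\<A> \<noteq> {}" using low e(2) by auto
  ultimately show thesis
    using that low fin ob \<open>disjoint \<A>\<close> unfolding box_family_def by blast
qed

text \<open>For box approximations with error \<open>e\<close> the minimum drops by at most
  \<open>e\<close> and each of the two defects is at most \<open>e\<close>. This gives the loss
  \<open>3 * e\<close>, which tends to 0.\<close>

lemma crossing_bound_borel:
  fixes A B C :: "'a::euclidean_space set"
  assumes A: "A \<in> sets borel" "bounded A" and B: "B \<in> sets borel" "bounded B"
    and C: "C \<in> sets borel" "emeasure lborel C < \<infinity>" and \<delta>: "0 \<le> \<delta>"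
    and cross: "\<And>x y. x \<in> A \<Longrightarrow> y \<in> B \<Longrightarrow>
      \<exists>u v. 0 \<le> u \<and> v \<le> 1 \<and> \<delta> \<le> v - u \<and> (\<forall>t\<in>{u<..<v}. (1 - t) *\<^sub>R x + t *\<^sub>R y \<in> C)"
  shows "\<delta> * min (measure lborel A) (measure lborel B) \<le> measure lborel C"
proof -
  define M where "M = min (measure lborel A) (measure lborel B)"
  have lm: "A \<in> lmeasurable" "B \<in> lmeasurable"
    using A B by (auto intro!: bounded_set_imp_lmeasurable)
  have eps: "\<delta> * (M - 3 * e) \<le> measure lborel C" if e: "0 < e" "e < M" for e
  proof -
    have e': "e < measure lebesgue A" "e < measure lebesgue B" using e A B by (auto simp: M_def)
    obtain \<A> where \<A>: "box_family \<A>" "measure lebesgue (\<Union>\<A> - A) \<le> e" "measure lebesgue A - e \<le> measure lebesgue (\<Union>\<A>)"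
      using box_family_approx[OF lm(1) A(2) e(1) e'(1)] .
    obtain \<B> where \<B>: "box_family \<B>" "measure lebesgue (\<Union>\<B> - B) \<le> e" "measure lebesgue B - e \<le> measure lebesgue (\<Union>\<B>)"
      using box_family_approx[OF lm(2) B(2) e(1) e'(2)] .
    note fA = box_family_properties[OF \<A>(1)] and fB = box_family_properties[OF \<B>(1)]
    obtain R where R: "matching (\<Union>\<A>) (\<Union>\<B>) R" using matching_exists[OF \<A>(1) \<B>(1)] ..
    have "\<delta> * (min (measure lborel (\<Union>\<A>)) (measure lborel (\<Union>\<B>)) - measure lborel (\<Union>\<A> - A) - measure lborel (\<Union>\<B> - B))
        \<le> measure lborel C"
      by (rule matching_crossing[OF R _ fA(6) _ A(1) B(1) C \<delta> cross])
        (use fA(1,2) fB(1,2) in \<open>auto simp: fmeasurable_def\<close>)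
    moreover have "M - 3 * e \<le> min (measure lborel (\<Union>\<A>)) (measure lborel (\<Union>\<B>)) - measure lborel (\<Union>\<A> - A) - measure lborel (\<Union>\<B> - B)"
      using \<A>(2,3) \<B>(2,3) A(1) B(1) fA(1) fB(1) by (auto simp: M_def)
    ultimately show ?thesis using mult_left_mono[OF _ \<delta>] by (meson order_trans)
  qed
  show ?thesis
  proof (cases "M > 0")
    case True
    have "((\<lambda>e. \<delta> * (M - 3 * e)) \<longlongrightarrow> \<delta> * (M - 3 * 0)) (at_right 0)"
      by (intro tendsto_intros)
    moreover have "eventually (\<lambda>e. \<delta> * (M - 3 * e) \<le> measure lborel C) (at_right 0)"
      using eps True by (intro eventually_at_rightI[of 0 M]) auto
    ultimately have "\<delta> * (M - 3 * 0) \<le> measure lborel C"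
      by (rule tendsto_upperbound) simp
    then show ?thesis by (simp add: M_def)
  next
    case False
    then have "M = 0" by (auto simp: M_def min_def not_less intro: antisym split: if_splits)
    then show ?thesis by (simp add: M_def[symmetric])
  qed
qed

text \<open>\<open>A\<close> and \<open>B\<close> shrink to Borel subsets and \<open>C\<close> grows
  to a Borel superset, each by a null set; these are the directions that preserve the crossing
  hypothesis.\<close>

lemma crossing_bound:
  fixes A B C :: "'a::euclidean_space set"
  assumes A: "A \<in> sets lebesgue" "bounded A" and B: "B \<in> sets lebesgue" "bounded B"
    and C: "C \<in> lmeasurable" and \<delta>: "0 \<le> \<delta>"
    and cross: "\<And>x y. x \<in> A \<Longrightarrow> y \<in> B \<Longrightarrow>
      \<exists>u v. 0 \<le> u \<and> v \<le> 1 \<and> \<delta> \<le> v - u \<and> (\<forall>t\<in>{u<..<v}. (1 - t) *\<^sub>R x + t *\<^sub>R y \<in> C)"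
  shows "\<delta> * min (measure lebesgue A) (measure lebesgue B) \<le> measure lebesgue C"
proof -
  obtain A0 NA where A0: "fsigma A0" "NA \<in> null_sets lebesgue" "A0 \<union> NA = A"
    using lebesgue_set_almost_fsigma[OF A(1)] by metis
  obtain B0 NB where B0: "fsigma B0" "NB \<in> null_sets lebesgue" "B0 \<union> NB = B"
    using lebesgue_set_almost_fsigma[OF B(1)] by metis
  obtain C0 NC where C0: "gdelta C0" "NC \<in> null_sets lebesgue" "C \<union> NC = C0"
    using lebesgue_set_almost_gdelta[OF fmeasurableD[OF C]] by metis
  have b: "A0 \<in> sets borel" "B0 \<in> sets borel" "C0 \<in> sets borel"
    using A0(1) B0(1) C0(1) by (auto elim!: fsigma.cases gdelta.cases)
  have C0m: "C0 \<in> lmeasurable"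
    using C C0 by (metis fmeasurable.Un negligible_iff_null_sets negligible_imp_measurable)
  have eq: "measure lebesgue A = measure lborel A0" "measure lebesgue B = measure lborel B0"
      "measure lebesgue C = measure lborel C0"
    using b measure_Un_null_set[of A0 lebesgue NA] measure_Un_null_set[of B0 lebesgue NB]
      measure_Un_null_set[of C lebesgue NC] A0 B0 C0 C by (auto simp: fmeasurableD)
  show ?thesis
    unfolding eq
  proof (rule crossing_bound_borel[OF b(1) _ b(2) _ b(3) _ \<delta>])
    show "bounded A0" "bounded B0" using A B A0 B0 bounded_subset by blast+
    show "emeasure lborel C0 < \<infinity>" using C0m b by (auto simp: fmeasurable_def)
    fix x y assume "x \<in> A0" "y \<in> B0"
    then have "x \<in> A" "y \<in> B" using A0(3) B0(3) by auto
    from cross[OF this] show "\<exists>u v. 0 \<le> u \<and> v \<le> 1 \<and> \<delta> \<le> v - u \<and> (\<forall>t\<in>{u<..<v}. (1 - t) *\<^sub>R x + t *\<^sub>R y \<in> C0)"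
      using C0(3) by blast
  qed
qed

section \<open>Segments between the two parts, and the final estimate\<close>

lemma segment_crossing:
  fixes x y :: "'a::euclidean_space"
  assumes xy: "x \<in> S1" "y \<in> S2" and seg: "closed_segment x y \<subseteq> S1 \<union> S2 \<union> S3"
    and D: "dist x y \<le> D" "0 < D"
  shows "\<exists>u v. 0 \<le> u \<and> v \<le> 1 \<and> setdist S1 S2 / D \<le> v - u \<and> (\<forall>t\<in>{u<..<v}. (1 - t) *\<^sub>R x + t *\<^sub>R y \<in> S3)"
proof -
  define z where "z t = (1 - t) *\<^sub>R x + t *\<^sub>R y" for t
  \<comment> \<open>\<open>v\<close> is the infimum of the times in \<open>S2\<close>, and
    \<open>u\<close> the supremum of the times up to \<open>v\<close> in \<open>S1\<close>. Strictly
    between them only \<open>S3\<close> is left.\<close>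
  define V where "V = {t. 0 \<le> t \<and> t \<le> 1 \<and> z t \<in> S2}"
  define v where "v = Inf V"
  define U where "U = {t. 0 \<le> t \<and> t \<le> v \<and> z t \<in> S1}"
  define u where "u = Sup U"
  have "1 \<in> V" using xy by (simp add: V_def z_def)
  have Vb: "bdd_below V" by (rule bdd_belowI[of _ 0]) (simp add: V_def)
  have v: "0 \<le> v" "v \<le> 1"
    using \<open>1 \<in> V\<close> Vb unfolding v_def by (auto intro!: cInf_greatest cInf_lower simp: V_def)
  have "0 \<in> U" using xy v by (simp add: U_def z_def)
  have Ub: "bdd_above U" by (rule bdd_aboveI[of _ v]) (simp add: U_def)
  have u: "0 \<le> u" "u \<le> v"
    using \<open>0 \<in> U\<close> Ub unfolding u_def by (auto intro!: cSup_least cSup_upper simp: U_def)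
  have dz: "dist (z s) (z t) = \<bar>s - t\<bar> * dist x y" for s t
  proof -
    have "z s - z t = (t - s) *\<^sub>R (x - y)" by (simp add: z_def algebra_simps)
    then show ?thesis by (simp add: dist_norm abs_minus_commute)
  qed
  have "z t \<in> S3" if "u < t" "t < v" for t
  proof -
    have "z t \<in> closed_segment x y"
      using that u v unfolding closed_segment_def z_def by (intro CollectI exI[of _ t]) auto
    moreover have "t \<notin> V" using that(2) cInf_lower[OF _ Vb, of t] by (auto simp: v_def)
    moreover have "t \<notin> U" using that(1) cSup_upper[OF _ Ub, of t] by (auto simp: u_def)
    ultimately show ?thesis using that u v seg by (auto simp: U_def V_def)
  qed
  moreover have "setdist S1 S2 / D \<le> v - u"
  proof (rule ccontr)
    assume "\<not> setdist S1 S2 / D \<le> v - u"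
    \<comment> \<open>The extrema need not be attained, so times close to them are used:
      \<open>\<epsilon>\<close> is half of the assumed deficit, one half for each end.\<close>
    define \<epsilon> where "\<epsilon> = (setdist S1 S2 / D - (v - u)) / 2"
    have \<epsilon>: "0 < \<epsilon>" "v - u + 2 * \<epsilon> = setdist S1 S2 / D"
      using \<open>\<not> setdist S1 S2 / D \<le> v - u\<close> by (auto simp: \<epsilon>_def diff_divide_distrib)
    obtain s where s: "s \<in> V" "s < v + \<epsilon>"
      using cInf_lessD[of V "v + \<epsilon>"] \<open>1 \<in> V\<close> \<epsilon>(1) unfolding v_def by auto
    obtain t where t: "t \<in> U" "u - \<epsilon> < t"
      using less_cSupD[of U "u - \<epsilon>"] \<open>0 \<in> U\<close> \<epsilon>(1) unfolding u_def by auto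
    have "v \<le> s" using cInf_lower[OF s(1) Vb] by (simp add: v_def)
    then have st: "0 \<le> s - t" "s - t < v - u + 2 * \<epsilon>" using s(2) t by (auto simp: U_def)
    have "setdist S1 S2 \<le> dist (z t) (z s)"
      using s t by (intro setdist_le_dist) (auto simp: U_def V_def)
    also have "\<dots> = (s - t) * dist x y" using st by (simp add: dz)
    also have "\<dots> \<le> (s - t) * D" using st D by (intro mult_left_mono) auto
    also have "\<dots> < setdist S1 S2 / D * D" using st \<epsilon> D by (intro mult_strict_right_mono) auto
    finally show False using D by simp
  qed
  ultimately show ?thesis using u v unfolding z_def by (intro exI[of _ u] exI[of _ v]) auto
qed

theorem theorem1p1:
  fixes S S1 S2 S3 :: "'a::euclidean_space set" and D :: real
  assumes "star_shaped_body S"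
    and "D = diameter S"
    and "eta S > 0"
    and "S1 \<in> sets lebesgue" and "S2 \<in> sets lebesgue" and "S3 \<in> sets lebesgue"
    and "S1 \<inter> S2 = {}" and "S1 \<inter> S3 = {}" and "S2 \<inter> S3 = {}"
    and "S1 \<union> S2 \<union> S3 = S"
  shows "vol S3 \<ge> eta S / (4 * D) * setdist S1 S2 * min (vol S1) (vol S2)"
proof (cases "D > 0 \<and> S1 \<noteq> {} \<and> S2 \<noteq> {}")
  case False
  \<comment> \<open>In each degenerate case the right-hand side is 0: division by zero yields 0, and
    so does \<open>setdist\<close> with an empty set.\<close>
  have "D \<ge> 0"
    using assms(1,2) by (auto simp: star_shaped_body_def compact_body_def compact_imp_bounded intro: diameter_ge_0)
  with False consider "D = 0" | "S1 = {}" | "S2 = {}" by fastforce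
  then show ?thesis by cases (auto simp: vol_def)
next
  case True
  define K where "K = kernel S"
  define \<delta> where "\<delta> = setdist S1 S2 / D"
  define M where "M = min (vol S1) (vol S2)"
  have D: "0 < D" and ne: "S1 \<noteq> {}" "S2 \<noteq> {}" using True by auto
  have bS: "bounded S" and cS: "S \<in> lmeasurable"
    using assms(1) by (auto simp: star_shaped_body_def compact_body_def compact_imp_bounded lmeasurable_compact)
  have KS: "K \<subseteq> S" by (auto simp: K_def kernel_def)
  have K0: "vol K > 0" and S0: "vol S > 0"
    using assms(3) by (auto simp: eta_def K_def vol_def zero_less_divide_iff measure_nonneg not_less[symmetric])
  \<comment> \<open>A non-measurable set has \<open>measure\<close> 0 by convention, so positive
    volume forces measurability.\<close>
  have Km: "K \<in> sets lebesgue"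
  proof (rule ccontr)
    assume "K \<notin> sets lebesgue"
    then have "vol K = 0" by (simp add: vol_def measure_notin_sets)
    then show False using K0 by simp
  qed
  have lm: "X \<in> lmeasurable" if "X \<subseteq> S" "X \<in> sets lebesgue" for X
    using fmeasurableI2[OF cS that] .
  have sub: "S1 \<subseteq> S" "S2 \<subseteq> S" "S3 \<subseteq> S" using assms(10) by auto
  have bd: "bounded X" if "X \<subseteq> S" for X using bS that bounded_subset by blast
  have dist: "dist x y \<le> D" if "x \<in> S" "y \<in> S" for x y
    using diameter_bounded_bound[OF bS that] assms(2) by simp
  have \<delta>0: "0 \<le> \<delta>" using D by (simp add: \<delta>_def setdist_pos_le)
  \<comment> \<open>Two points of \<open>S\<close> are at most \<open>D\<close> apart. The bound
    lets \<open>\<delta>\<close> multiply the volume of \<open>K \<inter> S3\<close> without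
    exceeding that of \<open>S3\<close>.\<close>
  have \<delta>1: "\<delta> \<le> 1"
  proof -
    obtain x y where "x \<in> S1" "y \<in> S2" using ne by auto
    then have "setdist S1 S2 \<le> dist x y" "x \<in> S" "y \<in> S" using setdist_le_dist sub by auto
    then have "setdist S1 S2 \<le> D" using dist[of x y] by linarith
    then show ?thesis using D by (simp add: \<delta>_def)
  qed
  have cross: "\<exists>u v. 0 \<le> u \<and> v \<le> 1 \<and> \<delta> \<le> v - u \<and> (\<forall>t\<in>{u<..<v}. (1 - t) *\<^sub>R x + t *\<^sub>R y \<in> S3)"
    if "x \<in> S1" "y \<in> S2" "x \<in> K \<or> y \<in> K" for x y
  proof -
    \<comment> \<open>The endpoint in the kernel sees the other one; symmetry of segments covers
      both cases.\<close>
    have "closed_segment x y \<subseteq> S"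
      using that sub closed_segment_commute[of x y] unfolding K_def kernel_def by blast
    then show ?thesis
      using segment_crossing[of x S1 y S2 S3 D] that(1,2) dist[of x y] sub D assms(10) unfolding \<delta>_def by blast
  qed
  have b1: "\<delta> * min (vol S1) (vol (K \<inter> S2)) \<le> vol S3" unfolding vol_def
    by (rule crossing_bound[OF _ bd _ bd _ \<delta>0]; (intro lm cross)?; use assms(4-6) sub Km in blast)
  have b2: "\<delta> * min (vol (K \<inter> S1)) (vol S2) \<le> vol S3" unfolding vol_def
    by (rule crossing_bound[OF _ bd _ bd _ \<delta>0]; (intro lm cross)?; use assms(4-6) sub Km in blast)
  have "vol (K \<inter> S3) \<le> vol S3" unfolding vol_def
    using lm[OF sub(3) assms(6)] assms(6) Km by (intro measure_mono_fmeasurable) auto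
  then have b3: "\<delta> * vol (K \<inter> S3) \<le> vol S3"
    using \<delta>0 \<delta>1 mult_left_le_one_le[of "vol (K \<inter> S3)" \<delta>] by (auto simp: vol_def)
  have Ksum: "vol K \<le> vol (K \<inter> S1) + vol (K \<inter> S2) + vol (K \<inter> S3)"
  proof -
    have "K = (K \<inter> S1 \<union> K \<inter> S2) \<union> K \<inter> S3" using KS assms(10) by auto
    then have "vol K \<le> vol (K \<inter> S1 \<union> K \<inter> S2) + vol (K \<inter> S3)"
      unfolding vol_def using measure_Un_le[of "K \<inter> S1 \<union> K \<inter> S2" lebesgue "K \<inter> S3"] Km assms(4-6) by auto
    also have "\<dots> \<le> vol (K \<inter> S1) + vol (K \<inter> S2) + vol (K \<inter> S3)"
      unfolding vol_def using measure_Un_le[of "K \<inter> S1" lebesgue "K \<inter> S2"] Km assms(4-6) by auto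
    finally show ?thesis .
  qed
  have M: "0 \<le> M" "M \<le> vol S1" "M \<le> vol S2" by (auto simp: M_def vol_def)
  \<comment> \<open>\<open>S1\<close> and \<open>S2\<close> are disjoint subsets of
    \<open>S\<close>, each of volume at least \<open>M\<close>.\<close>
  have SM: "2 * M \<le> vol S"
  proof -
    have "vol S1 + vol S2 = vol (S1 \<union> S2)"
      unfolding vol_def using fmeasurableD2[OF lm[OF sub(1) assms(4)]] fmeasurableD2[OF lm[OF sub(2) assms(5)]] assms(4,5,7)
      by (intro measure_Union[symmetric]) (simp_all del: emeasure_completion)
    also have "\<dots> \<le> vol S"
      unfolding vol_def using sub assms(4,5) cS by (intro measure_mono_fmeasurable) auto
    finally show ?thesis using M by linarith
  qed
  have "vol K \<le> vol S" unfolding vol_def using KS Km cS by (intro measure_mono_fmeasurable) auto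
  then have eta1: "eta S \<le> 1" using S0 by (simp add: eta_def K_def)
  have etaK: "vol K = eta S * vol S" using S0 by (simp add: eta_def K_def)
  \<comment> \<open>\<open>\<delta> * c\<close> is the bound to be proved. The factor 1/4 gives both
    \<open>c \<le> M\<close>, as \<open>eta S \<le> 1\<close>, and \<open>3 * c \<le> vol K\<close>,
    as \<open>vol K\<close> is at least \<open>2 * eta S * M\<close>; the latter is what choosing
    among three pieces of \<open>K\<close> needs.\<close>
  define c where "c = eta S * M / 4"
  have cM: "c \<le> M"
    using mult_right_mono[OF eta1 M(1)] M(1) by (simp add: c_def)
  have cK: "3 * c \<le> vol K"
  proof -
    have "eta S * (2 * M) \<le> vol K" unfolding etaK using SM assms(3) by (intro mult_left_mono) auto
    moreover have "0 \<le> eta S * M" using assms(3) M(1) by simp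
    ultimately show ?thesis by (simp add: c_def)
  qed
  then consider "c \<le> vol (K \<inter> S1)" | "c \<le> vol (K \<inter> S2)" | "c \<le> vol (K \<inter> S3)"
    using Ksum by linarith
  then have "\<delta> * c \<le> vol S3"
  proof cases
    case 1
    then have "\<delta> * c \<le> \<delta> * min (vol (K \<inter> S1)) (vol S2)" using cM M \<delta>0 by (intro mult_left_mono) auto
    then show ?thesis using b2 by linarith
  next
    case 2
    then have "\<delta> * c \<le> \<delta> * min (vol S1) (vol (K \<inter> S2))" using cM M \<delta>0 by (intro mult_left_mono) auto
    then show ?thesis using b1 by linarith
  next
    case 3
    then have "\<delta> * c \<le> \<delta> * vol (K \<inter> S3)" using \<delta>0 by (intro mult_left_mono) auto
    then show ?thesis using b3 by linarith
  qed
  then show ?thesis unfolding \<delta>_def c_def M_def by (simp add: field_simps)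
qed

end
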